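(* There exist a constant $c > 0$ and, for each $n \ge 2$, a regular language $L_n$ that is not factor-convex and is accepted by a DFA with $O(n)$ states, such that every witness $(u,v,w)$ to the failure of factor-convexity of $L_n$ satisfies $|w| \ge c n^3$; i.e. the size of the minimal witness is $\Omega(n^3)$.
   Context: A word $u$ is a factor of $v$ if $v = xuy$ for some words $x,y$. A witness to the failure of factor-convexity of $L$ is a triple $(u,v,w)$ with $u,w \in L$, $v \notin L$, $u$ a factor of $v$ and $v$ a factor of $w$; its size is $|w|$. $L$ is factor-convex iff no witness exists. *)

theory Defs
  imports Complex_Main "HOL-Library.Sublist" "HOL-Library.Landau_Symbols"
begin

text \<open>Complete DFAs over an explicit alphabet.\<close>

record ('s, 'a) dfa =
  states :: "'s set"
  alphabet :: "'a set"
  start :: 's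
  accepting :: "'s set"
  step :: "'s \<Rightarrow> 'a \<Rightarrow> 's"

definition is_dfa :: "('s, 'a) dfa \<Rightarrow> bool" where
  "is_dfa M \<longleftrightarrow>
     finite (states M) \<and> finite (alphabet M) \<and>
     start M \<in> states M \<and> accepting M \<subseteq> states M \<and>
     (\<forall>q\<in>states M. \<forall>a\<in>alphabet M. step M q a \<in> states M)"

definition dfa_language :: "('s, 'a) dfa \<Rightarrow> 'a list set" where
  "dfa_language M = {w \<in> lists (alphabet M). foldl (step M) (start M) w \<in> accepting M}"

text \<open>Taking the states in \<open>nat\<close> is no restriction, since state sets are finite.\<close>

definition regular :: "'a list set \<Rightarrow> bool" where
  "regular L \<longleftrightarrow> (\<exists>M :: (nat, 'a) dfa. is_dfa M \<and> dfa_language M = L)"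

text \<open>The factor relation on words is \<^const>\<open>sublist\<close> (contiguous sublists).\<close>

definition factor_convexity_witness ::
    "'a list set \<Rightarrow> 'a list \<Rightarrow> 'a list \<Rightarrow> 'a list \<Rightarrow> bool" where
  "factor_convexity_witness L u v w \<longleftrightarrow>
     u \<in> L \<and> v \<notin> L \<and> w \<in> L \<and> sublist u v \<and> sublist v w"

definition factor_convex :: "'a list set \<Rightarrow> bool" where
  "factor_convex L \<longleftrightarrow> \<not> (\<exists>u v w. factor_convexity_witness L u v w)"

text \<open>Only meaningful if \<open>L\<close> is not factor-convex.\<close>

definition min_witness_size :: "'a list set \<Rightarrow> nat" where
  "min_witness_size L = (LEAST k. \<exists>u v w. factor_convexity_witness L u v w \<and> length w = k)"

end

theory Submission imports Defs "HOL-Library.Countable" begin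

text \<open>
  Write \<open>B k\<close> for the word \<open>3 0\<^sup>k 4\<close>. The language \<open>L n\<close> consists of the words \<open>B k\<close> with
  \<open>2n-1\<close> dividing \<open>k+1\<close>, the words \<open>1 2 B k\<close> with \<open>2n\<close> dividing \<open>k+1\<close>, and the words \<open>2 B k\<close>
  with \<open>2n+1\<close> \<^emph>\<open>not\<close> dividing \<open>k+1\<close>. The letters \<open>3\<close> and \<open>4\<close> pin down the block inside a word,
  so a witness must be \<open>(B k, 2 B k, 1 2 B k)\<close> for a single \<open>k\<close>. Then the pairwise coprime numbers
  \<open>2n-1\<close>, \<open>2n\<close>, \<open>2n+1\<close> all divide \<open>k+1\<close>, hence so does their product. The automaton only needs
  one cyclic counter for each of the three moduli.
\<close>

section \<open>The language and its witnesses\<close>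

definition block :: "nat \<Rightarrow> nat list" where
  "block k = 3 # replicate k 0 @ [4]"

text \<open>Divisibility is asked of \<open>Suc k\<close> because 0 is a multiple of every modulus:
  with \<open>k\<close> in its place, \<open>k = 0\<close> would give a witness of length 4.\<close>

definition prefixed_blocks :: "nat \<Rightarrow> nat list set" where
  "prefixed_blocks n =
     {block k |k. 2 * n - 1 dvd Suc k} \<union>
     {1 # 2 # block k |k. 2 * n dvd Suc k} \<union>
     {2 # block k |k. \<not> 2 * n + 1 dvd Suc k}"

lemma length_block [simp]: "length (block k) = k + 2"
  by (simp add: block_def)

text \<open>The letter \<open>3\<close> occurs just once in \<open>p @ block k\<close>, and
  \<open>4\<close> just once in what follows it. Cutting there aligns the two sides, whatever
  \<open>xs\<close> and \<open>ys\<close> are.\<close>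

lemma append_block_eq_conv:
  assumes "3 \<notin> set p"
  shows "p @ block k = xs @ block j @ ys \<longleftrightarrow> p = xs \<and> k = j \<and> ys = []"
proof
  assume eq: "p @ block k = xs @ block j @ ys"
  have "p = xs \<and> replicate k 0 @ [4] = replicate j 0 @ 4 # ys"
    using eq assms by (subst append_Cons_eq_iff [symmetric, where x = 3]) (auto simp: block_def)
  moreover from this have "replicate k (0::nat) = replicate j 0 \<and> [] = ys"
    by (subst append_Cons_eq_iff [symmetric, where x = 4]) auto
  ultimately show "p = xs \<and> k = j \<and> ys = []"
    by (metis length_replicate)
qed simp

lemma block_eq_iff [simp]: "block k = block j \<longleftrightarrow> k = j"
  using append_block_eq_conv[of "[]" k "[]" j "[]"] by simp

lemma block_neq_Cons [simp]: "a \<noteq> 3 \<Longrightarrow> block k \<noteq> a # xs" "a \<noteq> 3 \<Longrightarrow> a # xs \<noteq> block k"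
  by (auto simp: block_def)

lemma block_in_prefixed_blocks_iff [simp]:
  "block k \<in> prefixed_blocks n \<longleftrightarrow> 2 * n - 1 dvd Suc k"
  "1 # 2 # block k \<in> prefixed_blocks n \<longleftrightarrow> 2 * n dvd Suc k"
  "2 # block k \<in> prefixed_blocks n \<longleftrightarrow> \<not> 2 * n + 1 dvd Suc k"
  by (auto simp: prefixed_blocks_def)

lemma prefixed_blocks_prefix:
  assumes "w \<in> prefixed_blocks n"
  obtains p k where "w = p @ block k" "p \<in> {[], [2], [1, 2]}"
  using assms that[of "[]"] that[of "[2]"] that[of "[1, 2]"]
  unfolding prefixed_blocks_def by auto

lemma witness_prefixed_blocks_iff:
  "factor_convexity_witness (prefixed_blocks n) u v w \<longleftrightarrow>
     (\<exists>k. u = block k \<and> v = 2 # block k \<and> w = 1 # 2 # block k \<and>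
        2 * n - 1 dvd Suc k \<and> 2 * n dvd Suc k \<and> 2 * n + 1 dvd Suc k)"
  (is "?lhs \<longleftrightarrow> ?rhs")
proof
  assume ?lhs
  then have u: "u \<in> prefixed_blocks n" and v: "v \<notin> prefixed_blocks n"
    and w: "w \<in> prefixed_blocks n" and "sublist u v" "sublist v w"
    by (auto simp: factor_convexity_witness_def)
  then obtain xs ys xs' ys' where v_eq: "v = xs' @ u @ ys'" and w_eq: "w = xs @ v @ ys"
    by (auto simp: sublist_def)
  obtain p j where p: "u = p @ block j" "p \<in> {[], [2], [1, 2]}"
    using u by (rule prefixed_blocks_prefix)
  obtain q k where q: "w = q @ block k" "q \<in> {[], [2], [1, 2]}"
    using w by (rule prefixed_blocks_prefix)
  have "q @ block k = (xs @ xs' @ p) @ block j @ (ys' @ ys)"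
    using v_eq w_eq p(1) q(1) by simp
  moreover have "3 \<notin> set q"
    using q(2) by auto
  ultimately have *: "q = xs @ xs' @ p" "k = j" "ys' = []" "ys = []"
    by (metis append_block_eq_conv append_is_Nil_conv)+
  \<comment> \<open>An empty \<open>xs'\<close> would give \<open>v = u\<close>, an empty
    \<open>xs\<close> would give \<open>w = v\<close>, against \<open>v\<close> lying outside the
    language. So \<open>q\<close> begins with two nonempty pieces, which leaves only
    \<open>[1, 2]\<close>.\<close>
  have "xs' \<noteq> []" "xs \<noteq> []"
    using u v w v_eq w_eq * by auto
  then have "q = [1, 2]" "xs = [1]" "xs' = [2]" "p = []"
    using q(2) *(1) by (auto simp: neq_Nil_conv append_eq_Cons_conv)
  then show ?rhs
    using u v w v_eq p(1) q(1) * by (auto simp del: One_nat_def)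
next
  assume ?rhs
  then obtain k where k: "u = block k" "v = 2 # block k" "w = 1 # 2 # block k"
    "2 * n - 1 dvd Suc k" "2 * n dvd Suc k" "2 * n + 1 dvd Suc k"
    by blast
  then show ?lhs
    by (auto simp: factor_convexity_witness_def sublist_Cons_right simp del: One_nat_def)
qed

section \<open>Size of the witnesses\<close>

lemma consecutive_coprime_dvd_mult:
  fixes n K :: nat
  assumes "n \<ge> 1" "2 * n - 1 dvd K" "2 * n dvd K" "2 * n + 1 dvd K"
  shows "(2 * n - 1) * (2 * n) * (2 * n + 1) dvd K"
proof -
  obtain m where n: "n = Suc m"
    using assms(1) by (cases n) auto
  \<comment> \<open>These are \<open>2 * n - 1\<close> and \<open>2 * n + 1\<close> without
    truncated subtraction. They differ by 2, so their gcd is that of an odd number and 2.\<close>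
  have "coprime (2 * m + 1) (2 * m + 1 + 2)"
    by (simp only: coprime_iff_gcd_eq_1 gcd_add2) (simp flip: coprime_iff_gcd_eq_1)
  then have "coprime (2 * n - 1) (2 * n + 1)"
    by (simp add: n)
  moreover have "coprime (2 * n) (2 * n + 1)"
    by (rule coprime_add_one_right)
  ultimately have "coprime ((2 * n - 1) * (2 * n)) (2 * n + 1)"
    by simp
  moreover have "coprime (2 * n - 1) (2 * n)"
    using assms(1) by (intro coprime_diff_one_left_nat) auto
  then have "(2 * n - 1) * (2 * n) dvd K"
    using assms(2,3) by (simp only: divides_mult)
  ultimately show ?thesis
    using assms(4) by (simp only: divides_mult)
qed

lemma witness_prefixed_blocks_length:
  assumes "n \<ge> 1" "factor_convexity_witness (prefixed_blocks n) u v w"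
  shows "n ^ 3 \<le> length w"
proof -
  obtain k where k: "w = 1 # 2 # block k" "2 * n - 1 dvd Suc k" "2 * n dvd Suc k" "2 * n + 1 dvd Suc k"
    using assms(2) by (auto simp: witness_prefixed_blocks_iff)
  have "n ^ 3 = n * n * n"
    by (simp add: power3_eq_cube)
  \<comment> \<open>Factor by factor; \<open>n \<le> 2 * n - 1\<close> relies on
    \<open>n \<ge> 1\<close>.\<close>
  also have "\<dots> \<le> (2 * n - 1) * (2 * n) * (2 * n + 1)"
    using assms(1) by (intro mult_le_mono) auto
  also have "\<dots> \<le> Suc k"
    using assms(1) k by (intro dvd_imp_le consecutive_coprime_dvd_mult) auto
  also have "\<dots> \<le> length w"
    by (simp add: k(1))
  finally show ?thesis .
qed

lemma not_factor_convex_prefixed_blocks: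
  assumes "n \<ge> 1"
  shows "\<not> factor_convex (prefixed_blocks n)"
proof -
  \<comment> \<open>One zero fewer than the product of the moduli makes \<open>Suc k\<close> equal
    to it.\<close>
  define K where "K = (2 * n - 1) * (2 * n) * (2 * n + 1)"
  have "K > 0"
    using assms by (simp add: K_def)
  then obtain k where "Suc k = K"
    by (metis gr0_implies_Suc)
  then have "2 * n - 1 dvd Suc k" "2 * n dvd Suc k" "2 * n + 1 dvd Suc k"
    unfolding K_def by (metis dvd_triv_left dvd_triv_right dvd_mult2)+
  then show ?thesis
    unfolding factor_convex_def witness_prefixed_blocks_iff by blast
qed

lemma min_witness_size_prefixed_blocks:
  assumes "n \<ge> 1"
  shows "n ^ 3 \<le> min_witness_size (prefixed_blocks n)"
proof -
  \<comment> \<open>The \<open>LEAST\<close> value is attained only because some witness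
    exists.\<close>
  have "\<exists>k u v w. factor_convexity_witness (prefixed_blocks n) u v w \<and> length w = k"
    using not_factor_convex_prefixed_blocks[OF assms] by (auto simp: factor_convex_def)
  then have "\<exists>u v w. factor_convexity_witness (prefixed_blocks n) u v w \<and>
      length w = min_witness_size (prefixed_blocks n)"
    unfolding min_witness_size_def by (rule LeastI_ex)
  then show ?thesis
    using witness_prefixed_blocks_length[OF assms] by metis
qed

section \<open>An automaton of linear size\<close>

text \<open>
  In state \<open>Count d b i\<close> the number of zeros read so far is congruent to \<open>i\<close> modulo \<open>d\<close>; the flag
  \<open>b\<close> says whether \<open>d\<close> is required to divide, or not to divide, the final number of zeros plus one.
\<close>

datatype counter_state = Start | Read1 | Read12 | Read2 | Count nat bool nat | Final | Sink

instance counter_state :: countable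
  by countable_datatype

fun counter_step :: "nat \<Rightarrow> counter_state \<Rightarrow> nat \<Rightarrow> counter_state" where
  "counter_step n Start a =
     (if a = 1 then Read1 else if a = 2 then Read2
      else if a = 3 then Count (2 * n - 1) True 0 else Sink)"
| "counter_step n Read1 a = (if a = 2 then Read12 else Sink)"
| "counter_step n Read12 a = (if a = 3 then Count (2 * n) True 0 else Sink)"
| "counter_step n Read2 a = (if a = 3 then Count (2 * n + 1) False 0 else Sink)"
| "counter_step n (Count d b i) a =
     (if a = 0 then Count d b (Suc i mod d)
      else if a = 4 \<and> (d dvd Suc i) = b then Final else Sink)"
| "counter_step n Final a = Sink"
| "counter_step n Sink a = Sink"

definition counter_states :: "nat \<Rightarrow> counter_state set" where
  "counter_states n = {Start, Read1, Read12, Read2, Final, Sink} \<union>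
     (Count (2 * n - 1) True ` {..<2 * n - 1} \<union>
      (Count (2 * n) True ` {..<2 * n} \<union> Count (2 * n + 1) False ` {..<2 * n + 1}))"

definition counter_dfa :: "nat \<Rightarrow> (counter_state, nat) dfa" where
  "counter_dfa n = \<lparr>states = counter_states n, alphabet = {..4}, start = Start,
     accepting = {Final}, step = counter_step n\<rparr>"

lemma foldl_counter_step_Sink [simp]: "foldl (counter_step n) Sink w = Sink"
  by (induction w) auto

lemma foldl_counter_step_Final [simp]: "foldl (counter_step n) Final w = Final \<longleftrightarrow> w = []"
  by (cases w) auto

lemma foldl_counter_step_Count:
  "foldl (counter_step n) (Count d b i) w = Final \<longleftrightarrow>
     (\<exists>k. w = replicate k 0 @ [4] \<and> (d dvd Suc (i + k)) = b)"
proof (induction w arbitrary: i)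
  case (Cons a w)
  \<comment> \<open>Reducing the counter modulo \<open>d\<close> preserves the test, so a zero may
    be moved from the word into the counter.\<close>
  have shift: "d dvd Suc (Suc i mod d + k) \<longleftrightarrow> d dvd Suc (i + Suc k)" for k
    by (simp add: dvd_eq_mod_eq_0 mod_simps flip: add_Suc_right)
  consider "a = 0" | "a = 4" | "a \<noteq> 0" "a \<noteq> 4"
    by blast
  then show ?case
  proof cases
    case 1
    have "(\<exists>k. 0 # w = replicate k 0 @ [4] \<and> (d dvd Suc (i + k)) = b) \<longleftrightarrow>
        (\<exists>k. w = replicate k 0 @ [4] \<and> (d dvd Suc (i + Suc k)) = b)" (is "(\<exists>k. ?P k) \<longleftrightarrow> _")
    proof -
      \<comment> \<open>\<open>?P 0\<close> fails since the word starts with \<open>0\<close> and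
        not \<open>4\<close>; this shifts the index to \<open>Suc k\<close>.\<close>
      have "(\<exists>k. ?P k) \<longleftrightarrow> ?P 0 \<or> (\<exists>k. ?P (Suc k))"
        by (metis not0_implies_Suc)
      then show ?thesis
        by simp
    qed
    then show ?thesis
      using 1 by (simp add: Cons.IH shift)
  next
    case 2
    have "4 # w = replicate k 0 @ [4] \<longleftrightarrow> k = 0 \<and> w = []" for k
      by (cases k) auto
    then show ?thesis
      using 2 by auto
  next
    case 3
    have "a # w \<noteq> replicate k 0 @ [4]" for k
      using 3 by (cases k) auto
    then show ?thesis
      using 3 by simp
  qed
qed simp

lemma foldl_counter_step_Start:
  "foldl (counter_step n) Start w = Final \<longleftrightarrow> w \<in> prefixed_blocks n"
proof -
  have Read12: "foldl (counter_step n) Read12 w = Final \<longleftrightarrow> (\<exists>k. w = block k \<and> 2 * n dvd Suc k)" for w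
    by (cases w) (auto simp: foldl_counter_step_Count block_def)
  have Read1: "foldl (counter_step n) Read1 w = Final \<longleftrightarrow> (\<exists>k. w = 2 # block k \<and> 2 * n dvd Suc k)" for w
    by (cases w) (auto simp: Read12)
  have Read2: "foldl (counter_step n) Read2 w = Final \<longleftrightarrow> (\<exists>k. w = block k \<and> \<not> 2 * n + 1 dvd Suc k)" for w
    by (cases w) (auto simp: foldl_counter_step_Count block_def)
  show ?thesis
    by (cases w) (auto simp: Read1 Read2 foldl_counter_step_Count prefixed_blocks_def block_def)
qed

lemma prefixed_blocks_subset_lists: "prefixed_blocks n \<subseteq> lists {..4}"
  by (auto simp: prefixed_blocks_def block_def)

lemma dfa_language_counter_dfa: "dfa_language (counter_dfa n) = prefixed_blocks n"
  using prefixed_blocks_subset_lists[of n]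
  by (auto simp: dfa_language_def counter_dfa_def foldl_counter_step_Start)

lemma is_dfa_counter_dfa:
  assumes "n \<ge> 1"
  shows "is_dfa (counter_dfa n)"
proof -
  \<comment> \<open>For \<open>n \<ge> 1\<close> all moduli are positive, so each set of residues
    contains 0 and is closed under the cyclic successor.\<close>
  have "counter_step n q a \<in> counter_states n" if "q \<in> counter_states n" for q a
    using that assms by (auto simp: counter_states_def)
  then show ?thesis
    by (auto simp: is_dfa_def counter_dfa_def counter_states_def)
qed

lemma card_counter_states_le: "card (counter_states n) \<le> 6 * n + 7"
proof -
  have image: "card (Count d b ` {..<d}) \<le> d" for d b
    using card_image_le[of "{..<d}" "Count d b"] by simp
  \<comment> \<open>The sum is \<open>6 * n + 6\<close> for \<open>n \<ge> 1\<close>, but 7 at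
    \<open>n = 0\<close>, where \<open>2 * n - 1\<close> truncates to 0.\<close>
  have "card (counter_states n) \<le> 6 + ((2 * n - 1) + (2 * n + (2 * n + 1)))"
    unfolding counter_states_def
    by (intro order_trans[OF card_Un_le] add_mono image) simp
  then show ?thesis
    by simp
qed

section \<open>Renaming of states and asymptotics\<close>

text \<open>Regularity is phrased with states in \<open>nat\<close>. The injection
  \<open>to_nat\<close> preserves acceptance and the number of states, and \<open>from_nat\<close>
  undoes it before each step.\<close>

definition nat_dfa :: "('s::countable, 'a) dfa \<Rightarrow> (nat, 'a) dfa" where
  "nat_dfa M = \<lparr>states = to_nat ` states M, alphabet = alphabet M, start = to_nat (start M),
     accepting = to_nat ` accepting M, step = (\<lambda>q a. to_nat (step M (from_nat q) a))\<rparr>"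

lemma is_dfa_nat_dfa: "is_dfa M \<Longrightarrow> is_dfa (nat_dfa M)"
  by (auto simp: is_dfa_def nat_dfa_def)

lemma dfa_language_nat_dfa: "dfa_language (nat_dfa M) = dfa_language M"
proof -
  have "foldl (step (nat_dfa M)) (to_nat q) w = to_nat (foldl (step M) q w)" for q w
    by (induction w arbitrary: q) (auto simp: nat_dfa_def)
  then show ?thesis
    by (auto simp: dfa_language_def nat_dfa_def)
qed

lemma card_states_nat_dfa: "card (states (nat_dfa M)) = card (states M)"
  by (simp add: nat_dfa_def card_image)

theorem theorem7:
  "\<exists>c::real. c > 0 \<and>
     (\<exists>(\<Sigma> :: nat set) (L :: nat \<Rightarrow> nat list set) (M :: nat \<Rightarrow> (nat, nat) dfa).
        finite \<Sigma> \<and>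
        (\<forall>n\<ge>2.
           regular (L n) \<and>
           \<not> factor_convex (L n) \<and>
           is_dfa (M n) \<and> alphabet (M n) = \<Sigma> \<and> dfa_language (M n) = L n \<and>
           (\<forall>u v w. factor_convexity_witness (L n) u v w \<longrightarrow>
              real (length w) \<ge> c * real n ^ 3)) \<and>
        (\<lambda>n. real (card (states (M n)))) \<in> O(\<lambda>n. real n) \<and>
        (\<lambda>n. real (min_witness_size (L n))) \<in> \<Omega>(\<lambda>n. real n ^ 3))"
proof -
  define M where "M n = nat_dfa (counter_dfa n)" for n
  have language: "dfa_language (M n) = prefixed_blocks n" for n
    by (simp add: M_def dfa_language_nat_dfa dfa_language_counter_dfa)
  have dfa: "is_dfa (M n)" if "n \<ge> 1" for n
    using that by (simp add: M_def is_dfa_nat_dfa is_dfa_counter_dfa)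
  have alphabet: "alphabet (M n) = {..4}" for n
    by (simp add: M_def nat_dfa_def counter_dfa_def)
  have card: "card (states (M n)) \<le> 6 * n + 7" for n
    using card_counter_states_le[of n] by (simp add: M_def card_states_nat_dfa counter_dfa_def)
  \<comment> \<open>For \<open>n \<ge> 1\<close> the constant 7 is at most \<open>7 * n\<close>,
    hence 13.\<close>
  have "real (card (states (M n))) \<le> 13 * real n" if "n \<ge> 1" for n
    using card[of n] that by simp
  then have states: "(\<lambda>n. real (card (states (M n)))) \<in> O(\<lambda>n. real n)"
    by (intro bigoI[where c = 13] eventually_mono[OF eventually_ge_at_top[of 1]]) simp
  have len: "real n ^ 3 \<le> real (length w)"
    if "n \<ge> 1" "factor_convexity_witness (prefixed_blocks n) u v w" for n u v w
    using witness_prefixed_blocks_length[OF that] by (simp flip: of_nat_power)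
  have "real n ^ 3 \<le> real (min_witness_size (prefixed_blocks n))" if "n \<ge> 1" for n
    using min_witness_size_prefixed_blocks[OF that] by (simp flip: of_nat_power)
  then have witness: "(\<lambda>n. real (min_witness_size (prefixed_blocks n))) \<in> \<Omega>(\<lambda>n. real n ^ 3)"
    by (intro landau_omega.bigI[where c = 1] eventually_mono[OF eventually_ge_at_top[of 1]]) simp_all
  have "regular (prefixed_blocks n)" if "n \<ge> 1" for n
    using dfa[OF that] language unfolding regular_def by blast
  \<comment> \<open>The constant is \<open>c = 1\<close>, and the five letters \<open>{..4}\<close>
    serve every \<open>n\<close>.\<close>
  then show ?thesis
    using language dfa alphabet states witness len not_factor_convex_prefixed_blocks
    by (intro exI[of _ 1] conjI exI[of _ "{..4}"] exI[of _ prefixed_blocks] exI[of _ M]) auto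
qed

end
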